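(* Consider the model, the truncated Markov chain, the terminal condition (return to the intended steady state $c=\pi=0$), and the parameter restrictions described in the context, including $$\psi>m_{x\pi}+\frac{(1-m_{xx})(\beta m_{\pi\pi}-1)}{\kappa(1+\eta\bar c)\sigma}.$$ Then the function $\bar d$ defined in the context is strictly decreasing on $(0,1)$ and, with the threshold $\bar p\in(0,1)$ defined in the context, the following hold for every given $p\in(0,1)$. 1. If $\bar d(p)<d<\bar d(0)$, then there exists a finite integer $\underline{\ell}$ such that, if $\ell\geq\underline{\ell}$, the ELB binds on impact (i.e. $\tilde\pi_t(\ell)\leq\bar\pi$), and in this case the equilibrium path contains a single switch from the ELB regime to the normal-time regime (i.e. there is $k\in\{0,\dots,\ell-2\}$ with $\tilde\pi_{t+n}(\ell)\leq\bar\pi$ for $n=0,\dots,k$ and $\tilde\pi_{t+n}(\ell)>\bar\pi$ for $n=k+1,\dots,\ell-1$); and if $\ell<\underline{\ell}$, the ELB never binds (i.e. $\tilde\pi_{t+n}(\ell)>\bar\pi$ for all $n=0,\dots,\ell-1$). 2. If $\bar d(p)<d<\bar d(0)$ and $p<\bar p$, then $\lim_{\ell\to\infty}\tilde\pi_t(\ell)=\pi^L_t$ and $\lim_{\ell\to\infty}\tilde c_t(\ell)=c^L_t$. 3. If $\bar d(p)<d<\bar d(0)$ and $p\geq\bar p$, then $\lim_{\ell\to\infty}\tilde\pi_t(\ell)=-\infty$.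
   Context: Parameters: $\sigma,\kappa,\eta,\psi,\mu>0$, $\beta\in(0,1)$, $\bar c\in(0,1)$, $m_{xx},m_{x\pi},m_{\pi\pi}\in(0,1]$. Write $K:=\kappa(1+\eta\bar c)$ and $\bar\pi:=-\mu/\psi$. Model (no government spending): for each date $t$, $$c_t=m_{xx}\mathbb{E}_tc_{t+1}-\sigma(i_t-m_{x\pi}\mathbb{E}_t\pi_{t+1}+d_t),\quad \pi_t=m_{\pi\pi}\beta\,\mathbb{E}_t\pi_{t+1}+Kc_t,\quad i_t=\max\{\psi\pi_t,-\mu\}.$$ Truncated Markov chain: at date $t$ the shock starts in the low state, $d_t=d$. In periods $t,\dots,t+\ell-1$, from the low state (value $d$) it stays there with probability $p$ and moves to the absorbing state (value $0$) with probability $1-p$; the absorbing state is never left. If still in the low state at $t+\ell-1$, it jumps deterministically to the absorbing state at $t+\ell$. Whenever the shock is in the absorbing state, $c=\pi=0$. For each finite $\ell\ge1$ the model has a unique equilibrium; $\tilde c_{t+n}(\ell),\tilde\pi_{t+n}(\ell)$, $n=0,\dots,\ell-1$, denote equilibrium consumption and inflation at $t+n$ conditional on the shock still being in the low state, so that conditional expectations at $t+n$ are $p$ times the low-state value at $t+n+1$ (and $0$ if $n=\ell-1$). Matrices (for $Y=[c\ \pi]^\top$): $$\mathbf{A}^*=\begin{bmatrix}m_{xx}&\sigma m_{x\pi}\\ Km_{xx}&\beta m_{\pi\pi}+\sigma Km_{x\pi}\end{bmatrix},\quad C^*=-\sigma\begin{bmatrix}1\\ K\end{bmatrix},\quad E^*=\sigma\mu\begin{bmatrix}1\\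 K\end{bmatrix}.$$ Thresholds: $\bar p$ is the unique root in $(0,1)$ of $F_L(p):=\det(I-p\mathbf{A}^* )=(1-pm_{xx})(1-p\beta m_{\pi\pi})-p\sigma Km_{x\pi}$; parameters are assumed to be such that $F_L(1)<0$, so that this root exists. $\bar d(p):=\mu F_N(p)/(\sigma\psi K)$ with $F_N(p):=(1-pm_{xx})(1-p\beta m_{\pi\pi})+\sigma K(\psi-pm_{x\pi})$; in particular $\bar d(0)=\mu(1+\sigma\psi K)/(\sigma\psi K)$. Constant liquidity-trap (ELB) solution under the untruncated two-state absorbing Markov chain: $[c^L_t\ \pi^L_t]^\top:=(I-p\mathbf{A}^* )^{-1}(C^*d+E^* )$ (used for $p<\bar p$). *)

theory Defs
  imports "HOL-Probability.Probability"
begin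

record params =
  \<sigma> :: real
  \<kappa> :: real
  \<eta> :: real
  \<psi> :: real
  \<mu> :: real
  \<beta> :: real
  cbar :: real
  m_xx :: real
  m_xpi :: real
  m_pipi :: real

definition admissible :: "params \<Rightarrow> bool" where
  "admissible P \<longleftrightarrow>
     \<sigma> P > 0 \<and> \<kappa> P > 0 \<and> \<eta> P > 0 \<and> \<psi> P > 0 \<and> \<mu> P > 0 \<and>
     0 < \<beta> P \<and> \<beta> P < 1 \<and> 0 < cbar P \<and> cbar P < 1 \<and>
     0 < m_xx P \<and> m_xx P \<le> 1 \<and> 0 < m_xpi P \<and> m_xpi P \<le> 1 \<and> 0 < m_pipi P \<and> m_pipi P \<le> 1"

definition slope :: "params \<Rightarrow> real" where
  "slope P = \<kappa> P * (1 + \<eta> P * cbar P)"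

definition pi_bar :: "params \<Rightarrow> real" where
  "pi_bar P = - \<mu> P / \<psi> P"

text \<open>Dates are counted from the initial date \<open>t\<close>, so \<open>n\<close> stands for \<open>t + n\<close>.\<close>

datatype shock = Low | Absorbing

fun shock_value :: "real \<Rightarrow> shock \<Rightarrow> real" where
  "shock_value d Low = d"
| "shock_value d Absorbing = 0"

text \<open>Law of the state at date \<open>n + 1\<close> given the state at date \<open>n\<close>, for truncation length \<open>l\<close>.\<close>

fun transition :: "real \<Rightarrow> nat \<Rightarrow> nat \<Rightarrow> shock \<Rightarrow> shock pmf" where
  "transition p l n Low =
     (if n + 1 < l then map_pmf (\<lambda>stay. if stay then Low else Absorbing) (bernoulli_pmf p)
      else return_pmf Absorbing)"
| "transition p l n Absorbing = return_pmf Absorbing"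

definition cond_exp_next ::
  "real \<Rightarrow> nat \<Rightarrow> (nat \<Rightarrow> shock \<Rightarrow> real) \<Rightarrow> nat \<Rightarrow> shock \<Rightarrow> real" where
  "cond_exp_next p l x n s = measure_pmf.expectation (transition p l n s) (x (n + 1))"

text \<open>
  Consumption, inflation and the interest rate are functions of the date and the current state.
  This loses no generality: being low at a date determines the whole history, and in the absorbing
  state \<open>c = \<pi> = 0\<close> is imposed. The pairs \<open>(n, Low)\<close> with \<open>n \<ge> l\<close> have probability zero; the
  equations are imposed there too, which does not affect the values at reachable pairs and makes
  the equilibrium unique as a triple of functions.
\<close>

definition equilibrium ::
  "params \<Rightarrow> real \<Rightarrow> real \<Rightarrow> nat \<Rightarrow> (nat \<Rightarrow> shock \<Rightarrow> real) \<Rightarrow> (nat \<Rightarrow> shock \<Rightarrow> real) \<Rightarrow>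
   (nat \<Rightarrow> shock \<Rightarrow> real) \<Rightarrow> bool" where
  "equilibrium P d p l c \<pi> i \<longleftrightarrow>
     (\<forall>n s.
        c n s = m_xx P * cond_exp_next p l c n s
          - \<sigma> P * (i n s - m_xpi P * cond_exp_next p l \<pi> n s + shock_value d s) \<and>
        \<pi> n s = m_pipi P * \<beta> P * cond_exp_next p l \<pi> n s + slope P * c n s \<and>
        i n s = max (\<psi> P * \<pi> n s) (- \<mu> P)) \<and>
     (\<forall>n. c n Absorbing = 0 \<and> \<pi> n Absorbing = 0)"

text \<open>Well defined by \<open>ex1_equilibrium\<close> below.\<close>

definition the_equilibrium ::
  "params \<Rightarrow> real \<Rightarrow> real \<Rightarrow> nat \<Rightarrow>
   (nat \<Rightarrow> shock \<Rightarrow> real) \<times> (nat \<Rightarrow> shock \<Rightarrow> real) \<times> (nat \<Rightarrow> shock \<Rightarrow> real)" where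
  "the_equilibrium P d p l = (THE (c, \<pi>, i). equilibrium P d p l c \<pi> i)"

definition c_tilde :: "params \<Rightarrow> real \<Rightarrow> real \<Rightarrow> nat \<Rightarrow> nat \<Rightarrow> real" where
  "c_tilde P d p l n = (case the_equilibrium P d p l of (c, \<pi>, i) \<Rightarrow> c n Low)"

definition pi_tilde :: "params \<Rightarrow> real \<Rightarrow> real \<Rightarrow> nat \<Rightarrow> nat \<Rightarrow> real" where
  "pi_tilde P d p l n = (case the_equilibrium P d p l of (c, \<pi>, i) \<Rightarrow> \<pi> n Low)"

definition A_star :: "params \<Rightarrow> real^2^2" where
  "A_star P = vector
     [vector [m_xx P, \<sigma> P * m_xpi P],
      vector [slope P * m_xx P, \<beta> P * m_pipi P + \<sigma> P * slope P * m_xpi P]]"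

definition C_star :: "params \<Rightarrow> real^2" where
  "C_star P = (- \<sigma> P) *\<^sub>R vector [1, slope P]"

definition E_star :: "params \<Rightarrow> real^2" where
  "E_star P = (\<sigma> P * \<mu> P) *\<^sub>R vector [1, slope P]"

text \<open>First component: consumption; second component: inflation.\<close>

definition elb_solution :: "params \<Rightarrow> real \<Rightarrow> real \<Rightarrow> real^2" where
  "elb_solution P d p = matrix_inv (mat 1 - p *\<^sub>R A_star P) *v (d *\<^sub>R C_star P + E_star P)"

definition F_L :: "params \<Rightarrow> real \<Rightarrow> real" where
  "F_L P p = det (mat 1 - p *\<^sub>R A_star P)"

definition F_N :: "params \<Rightarrow> real \<Rightarrow> real" where
  "F_N P p = (1 - p * m_xx P) * (1 - p * \<beta> P * m_pipi P)
     + \<sigma> P * slope P * (\<psi> P - p * m_xpi P)"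

text \<open>Well defined by \<open>ex1_p_bar\<close> below.\<close>

definition p_bar :: "params \<Rightarrow> real" where
  "p_bar P = (THE p. 0 < p \<and> p < 1 \<and> F_L P p = 0)"

definition d_bar :: "params \<Rightarrow> real \<Rightarrow> real" where
  "d_bar P p = \<mu> P * F_N P p / (\<sigma> P * \<psi> P * slope P)"

lemma slope_pos: "admissible P \<Longrightarrow> slope P > 0"
  by (simp add: admissible_def slope_def add_pos_pos)

lemma F_L_eq:
  "F_L P p = (1 - p * m_xx P) * (1 - p * \<beta> P * m_pipi P) - p * \<sigma> P * slope P * m_xpi P"
  unfolding F_L_def A_star_def by (simp add: det_2 mat_def algebra_simps)

lemma ex1_p_bar:
  assumes "admissible P" "F_L P 1 < 0"
  shows "\<exists>!p. 0 < p \<and> p < 1 \<and> F_L P p = 0"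
proof (rule ex_ex1I)
  have "continuous_on {0..1} (F_L P)"
    unfolding F_L_eq by (intro continuous_intros)
  moreover have F0: "F_L P 0 = 1"
    by (simp add: F_L_eq)
  ultimately obtain p where p: "0 \<le> p" "p \<le> 1" "F_L P p = 0"
    using IVT2'[of "F_L P" 1 0 0] assms(2) by auto
  moreover have "p \<noteq> 0" "p \<noteq> 1"
    using p(3) F0 assms(2) by auto
  ultimately show "\<exists>p. 0 < p \<and> p < 1 \<and> F_L P p = 0"
    by (intro exI[of _ p]) auto
next
  define a where "a = m_xx P * \<beta> P * m_pipi P"
  define b where "b = m_xx P + \<beta> P * m_pipi P + \<sigma> P * slope P * m_xpi P"
  have F: "F_L P q = 1 - b * q + a * q * q" for q
    by (simp add: F_L_eq a_def b_def algebra_simps)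
  have a: "a > 0"
    using assms(1) by (simp add: a_def admissible_def)
  have no: False if "0 < x" "x < y" "y < 1" "F_L P x = 0" "F_L P y = 0" for x y
  proof -
    have "(y - x) * (a * (x + y) - b) = F_L P y - F_L P x"
      by (simp add: F algebra_simps)
    hence b: "b = a * (x + y)"
      using that by simp
    have "1 = a * x * y"
      using that(4) by (simp add: F b algebra_simps)
    hence "F_L P 1 = a * (1 - x) * (1 - y)"
      by (simp add: F b algebra_simps)
    hence "F_L P 1 > 0"
      using a that by simp
    thus False
      using assms(2) by simp
  qed
  fix x y
  assume "0 < x \<and> x < 1 \<and> F_L P x = 0" "0 < y \<and> y < 1 \<and> F_L P y = 0"
  thus "x = y"
    using no[of x y] no[of y x] by (cases x y rule: linorder_cases) auto
qed

lemma cond_exp_next_Low: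
  assumes "0 \<le> p" "p \<le> 1"
  shows "cond_exp_next p l x n Low =
    (if n + 1 < l then p * x (n + 1) Low + (1 - p) * x (n + 1) Absorbing else x (n + 1) Absorbing)"
  using assms by (simp add: cond_exp_next_def)

lemma cond_exp_next_Absorbing: "cond_exp_next p l x n Absorbing = x (n + 1) Absorbing"
  by (simp add: cond_exp_next_def)

lemma static_unique:
  fixes s K f m a b c c' :: real
  assumes "s > 0" "K > 0" "f > 0"
    and "c = a - s * max (f * (b + K * c)) (- m)"
    and "c' = a - s * max (f * (b + K * c')) (- m)"
  shows "c = c'"
proof -
  have no: False if "x < y" "x = a - s * max (f * (b + K * x)) (- m)"
    "y = a - s * max (f * (b + K * y)) (- m)" for x y
  proof -
    have "f * (b + K * x) \<le> f * (b + K * y)"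
      using that(1) assms by simp
    hence "s * max (f * (b + K * x)) (- m) \<le> s * max (f * (b + K * y)) (- m)"
      using assms(1) by (intro mult_left_mono) auto
    thus False
      using that by linarith
  qed
  show ?thesis
    using no[of c c'] no[of c' c] assms by (cases c c' rule: linorder_cases) auto
qed

lemma static_exists:
  fixes s K f m a b :: real
  assumes "s > 0" "K > 0" "f > 0"
  shows "\<exists>c. c = a - s * max (f * (b + K * c)) (- m)"
proof -
  define D where "D = 1 + s * f * K"
  define c where "c = (a - s * f * b) / D"
  have D: "D > 0"
    using assms by (simp add: D_def add_pos_pos)
  hence "c * D = a - s * f * b"
    by (simp add: c_def)
  hence c: "c = a - s * (f * (b + K * c))"
    by (simp add: D_def algebra_simps)
  show ?thesis
  proof (cases "f * (b + K * c) \<ge> - m")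
    case True
    hence "c = a - s * max (f * (b + K * c)) (- m)"
      using c by (simp only: max_absorb1)
    thus ?thesis ..
  next
    case False
    have "D * (f * (b + K * (a + s * m)) + m) = D * D * (f * (b + K * c) + m)"
    proof -
      have "a = c * D + s * f * b"
        using \<open>c * D = a - s * f * b\<close> by simp
      thus ?thesis
        by (simp add: D_def algebra_simps)
    qed
    also have "\<dots> < 0"
      using False D by (simp add: mult_pos_neg)
    finally have "f * (b + K * (a + s * m)) < - m"
      using D by (simp add: mult_less_0_iff)
    thus ?thesis
      by (intro exI[of _ "a + s * m"]) (simp add: max_def)
  qed
qed

lemma ex1_equilibrium:
  assumes P: "admissible P" and p: "0 \<le> p" "p \<le> 1"
  shows "\<exists>!(c, \<pi>, i). equilibrium P d p l c \<pi> i"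
proof -
  have pos: "\<sigma> P > 0" "slope P > 0" "\<psi> P > 0"
    using P slope_pos by (auto simp: admissible_def)
  note E = cond_exp_next_Low[OF p] cond_exp_next_Absorbing
  define step where "step e g c \<longleftrightarrow>
      c = (m_xx P * e + \<sigma> P * m_xpi P * g - \<sigma> P * d)
        - \<sigma> P * max (\<psi> P * (m_pipi P * \<beta> P * g + slope P * c)) (- \<mu> P)" for e g c
  define C where "C e g = (SOME c. step e g c)" for e g
  define X where "X = rec_nat (0, 0) (\<lambda>_ (x, y).
     (C (p * x) (p * y), m_pipi P * \<beta> P * (p * y) + slope P * C (p * x) (p * y)))"
  have step_C: "step e g (C e g)" for e g
    unfolding C_def step_def by (rule someI_ex, rule static_exists) (use pos in auto)
  have step_unique: "c = c'" if "step e g c" "step e g c'" for e g c c'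
    using static_unique[OF pos] that unfolding step_def by blast
  have X_Suc: "X (Suc j) = (C (p * fst (X j)) (p * snd (X j)),
      m_pipi P * \<beta> P * (p * snd (X j)) + slope P * C (p * fst (X j)) (p * snd (X j)))"
    and X_0: "X 0 = (0, 0)" for j
    by (simp_all add: X_def case_prod_unfold)
  define c where "c n s = (case s of Low \<Rightarrow> fst (X (Suc (l - 1 - n))) | Absorbing \<Rightarrow> 0)" for n s
  define \<pi> where "\<pi> n s = (case s of Low \<Rightarrow> snd (X (Suc (l - 1 - n))) | Absorbing \<Rightarrow> 0)" for n s
  define i where "i n s = max (\<psi> P * \<pi> n s) (- \<mu> P)" for n s
  have Ec: "cond_exp_next p l c n Low = p * fst (X (l - 1 - n))"
    and Epi: "cond_exp_next p l \<pi> n Low = p * snd (X (l - 1 - n))" for n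
  proof -
    have "Suc (l - 1 - (n + 1)) = l - 1 - n" if "n + 1 < l"
      using that by linarith
    moreover have "l - 1 - n = 0" if "\<not> n + 1 < l"
      using that by linarith
    ultimately show "cond_exp_next p l c n Low = p * fst (X (l - 1 - n))"
      "cond_exp_next p l \<pi> n Low = p * snd (X (l - 1 - n))"
      by (auto simp: E c_def \<pi>_def X_0 simp del: One_nat_def diff_diff_left)
  qed
  have ex: "equilibrium P d p l c \<pi> i"
    unfolding equilibrium_def
  proof (intro conjI allI)
    fix n s
    have mu: "\<mu> P > 0"
      using P by (simp add: admissible_def)
    have *: "step (p * fst (X (l - 1 - n))) (p * snd (X (l - 1 - n))) (c n Low)"
      using step_C by (simp add: c_def X_Suc)
    show pi_eq: "\<pi> n s = m_pipi P * \<beta> P * cond_exp_next p l \<pi> n s + slope P * c n s"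
      by (cases s) (simp_all only: Epi, simp_all add: E c_def \<pi>_def X_Suc)
    show "c n s = m_xx P * cond_exp_next p l c n s
          - \<sigma> P * (i n s - m_xpi P * cond_exp_next p l \<pi> n s + shock_value d s)"
    proof (cases s)
      case Low
      show ?thesis
        using * unfolding step_def i_def pi_eq unfolding Low Ec Epi
        by (simp add: algebra_simps)
    next
      case Absorbing
      thus ?thesis
        using mu by (simp add: E c_def \<pi>_def i_def)
    qed
  qed (simp_all add: i_def c_def \<pi>_def)
  have unique: "c' = c \<and> \<pi>' = \<pi> \<and> i' = i" if eq: "equilibrium P d p l c' \<pi>' i'" for c' \<pi>' i'
  proof -
    have abs: "c' n Absorbing = 0" "\<pi>' n Absorbing = 0" for n
      using eq unfolding equilibrium_def by blast+
    have low: "c' n Low = c n Low \<and> \<pi>' n Low = \<pi> n Low" for n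
    proof (induction "l - n" arbitrary: n rule: less_induct)
      case less
      have IH: "c' (n + 1) Low = c (n + 1) Low \<and> \<pi>' (n + 1) Low = \<pi> (n + 1) Low" if "n + 1 < l"
        using that by (intro less) linarith
      have Ec': "cond_exp_next p l c' n Low = cond_exp_next p l c n Low"
        and Ep': "cond_exp_next p l \<pi>' n Low = cond_exp_next p l \<pi> n Low"
        using IH by (auto simp: E abs c_def \<pi>_def)
      have st: "step (cond_exp_next p l u n Low) (cond_exp_next p l v n Low) (u n Low)"
        and v: "v n Low = m_pipi P * \<beta> P * cond_exp_next p l v n Low + slope P * u n Low"
        if "equilibrium P d p l u v w" for u v w
      proof -
        have u: "u n Low = m_xx P * cond_exp_next p l u n Low
            - \<sigma> P * (w n Low - m_xpi P * cond_exp_next p l v n Low + d)"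
          and w: "w n Low = max (\<psi> P * v n Low) (- \<mu> P)"
          and v: "v n Low = m_pipi P * \<beta> P * cond_exp_next p l v n Low + slope P * u n Low"
          using that[unfolded equilibrium_def, THEN conjunct1, rule_format, of n Low,
              unfolded shock_value.simps]
          by blast+
        show "v n Low = m_pipi P * \<beta> P * cond_exp_next p l v n Low + slope P * u n Low"
          by (fact v)
        show "step (cond_exp_next p l u n Low) (cond_exp_next p l v n Low) (u n Low)"
          unfolding step_def by (rule trans[OF u[unfolded w v]]) (simp add: algebra_simps)
      qed
      have "c' n Low = c n Low"
        using st[OF eq] st[OF ex] unfolding Ec' Ep' by (rule step_unique)
      thus ?case
        using v[OF eq] v[OF ex] by (simp add: Ep')
    qed
    have "c' n s = c n s" "\<pi>' n s = \<pi> n s" for n s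
      using low abs by (cases s; simp add: c_def \<pi>_def)+
    moreover from this have "i' n s = i n s" for n s
      using eq unfolding equilibrium_def i_def by metis
    ultimately show ?thesis
      by (simp add: fun_eq_iff)
  qed
  show ?thesis
  proof (rule ex1I[of _ "(c, \<pi>, i)"])
    show "case (c, \<pi>, i) of (c, \<pi>, i) \<Rightarrow> equilibrium P d p l c \<pi> i"
      using ex by simp
  next
    fix x assume x: "case x of (c, \<pi>, i) \<Rightarrow> equilibrium P d p l c \<pi> i"
    obtain c' \<pi>' i' where x': "x = (c', \<pi>', i')"
      by (cases x)
    have "equilibrium P d p l c' \<pi>' i'"
      using x unfolding x' prod.case .
    from unique[OF this] show "x = (c, \<pi>, i)"
      unfolding x' by blast
  qed
qed

end

theory Submission
  imports Defs
begin

text \<open>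
  Let \<open>j\<close> count the remaining low-state periods. Eliminating consumption turns the model into a
  scalar recursion: low-state inflation satisfies \<open>x 0 = 0\<close> and \<open>x (j + 1) = min (h + A) (h / D)\<close>
  with \<open>h = (r1 + r2) x j - r1 r2 x (j - 1) - e\<close>, where \<open>j - 1\<close> is truncated at \<open>0\<close>, the first
  branch of the minimum is the ELB, and \<open>r1 < 1\<close>, \<open>r1 < r2\<close> are the (real) eigenvalues of
  \<open>p A_star\<close>. If the ELB never bound, \<open>x\<close> would decrease geometrically to the normal-time fixed
  point, which lies below \<open>pi_bar\<close> when \<open>d > d_bar p\<close>; so the ELB binds for some \<open>j\<close>. From the
  first such \<open>j\<close> on, the quasi-difference \<open>q = x j - r1 x (j - 1)\<close> follows \<open>q \<mapsto> r2 q + A - e\<close> and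
  never leaves the half-line \<open>q \<le> (1 - r1) pi_bar\<close>, which keeps the ELB binding. The recursion
  converges if \<open>r2 < 1\<close>, i.e. \<open>p < p_bar\<close>, and drifts to \<open>-\<infinity>\<close> if \<open>r2 \<ge> 1\<close>.
\<close>

section \<open>The scalar recursion\<close>

text \<open>In the model \<open>A\<close>, \<open>D\<close> and \<open>e\<close> are
  \<open>slope P\<close> times sigma times mu, one plus that product with psi, and that product with
  \<open>d\<close>; \<open>b\<close> is \<open>pi_bar P\<close>. Then \<open>kink\<close> makes the
  two branches meet at \<open>h = D * b\<close> with value \<open>b\<close>,
  \<open>contraction\<close> is \<open>F_N P p > 0\<close>, and \<open>normal_below\<close> and
  \<open>slack_at_end\<close> are the lower and upper bounds on \<open>d\<close>.\<close>

locale elb_recursion =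
  fixes x :: "nat \<Rightarrow> real" and r1 r2 A D b e :: real
  assumes x_0: "x 0 = 0"
    and x_Suc: "x (Suc j) =
      min ((r1 + r2) * x j - r1 * r2 * x (j - 1) - e + A)
          (((r1 + r2) * x j - r1 * r2 * x (j - 1) - e) / D)"
    and r1: "0 < r1" "r1 < 1" and r12: "r1 < r2"
    and D: "1 < D" and b: "b < 0" and kink: "D * b = b - A"
    and contraction: "r1 + r2 - r1 * r2 < D"
    and normal_below: "- e < (D - (r1 + r2) + r1 * r2) * b"
    and slack_at_end: "D * b < - e"
begin

section \<open>Regime choice in a single step\<close>

definition h :: "nat \<Rightarrow> real" where
  "h j = (r1 + r2) * x j - r1 * r2 * x (j - 1) - e"

lemma x_Suc_h: "x (Suc j) = min (h j + A) (h j / D)"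
  by (simp add: x_Suc h_def)

text \<open>As functions of \<open>h\<close> the ELB branch has slope 1 and the normal branch slope
  \<open>1 / D < 1\<close>. They cross at \<open>h = D * b\<close>, so to the left of it the ELB
  branch is the smaller one.\<close>

lemma binding:
  assumes "h j \<le> D * b"
  shows "x (Suc j) = h j + A" "x (Suc j) \<le> b"
proof -
  have "(D - 1) * h j \<le> (D - 1) * (D * b)"
    using assms D by (intro mult_left_mono) auto
  also have "\<dots> = - (D * A)"
    using kink by algebra
  finally have "h j + A \<le> h j / D"
    using D by (simp add: field_simps)
  thus *: "x (Suc j) = h j + A"
    by (simp add: x_Suc_h)
  show "x (Suc j) \<le> b"
    using assms kink by (simp add: *)
qed

lemma slack:
  assumes "D * b < h j"
  shows "x (Suc j) = h j / D" "b < x (Suc j)"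
proof -
  have "(D - 1) * (D * b) \<le> (D - 1) * h j"
    using assms D by (intro mult_left_mono) auto
  also have "(D - 1) * (D * b) = - (D * A)"
    using kink by algebra
  finally have "h j / D \<le> h j + A"
    using D by (simp add: field_simps)
  thus *: "x (Suc j) = h j / D"
    by (simp add: x_Suc_h)
  show "b < x (Suc j)"
    using assms D by (simp add: * field_simps)
qed

lemma x_Suc_le_iff: "x (Suc j) \<le> b \<longleftrightarrow> h j \<le> D * b"
  using binding(2)[of j] slack(2)[of j] by linarith

section \<open>Entry into the ELB regime\<close>

lemma x_1: "b < x 1"
  \<comment> \<open>With one low-state period left the continuation values vanish, so
    \<open>h 0 = - e\<close>.\<close>
  using slack(2)[of 0] slack_at_end by (simp add: h_def x_0)

lemma ex_binding: "\<exists>j. x j \<le> b"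
proof (rule ccontr)
  assume "\<not> ?thesis"
  hence above: "b < x j" for j
    by (simp add: not_le)
  define F where "F = D - (r1 + r2) + r1 * r2"
  have F: "F > 0"
    using contraction by (simp add: F_def)
  \<comment> \<open>The fixed point of the normal-time branch.\<close>
  define N where "N = - e / F"
  have FN: "F * N = - e"
    using F by (simp add: N_def)
  have N: "N < b"
    using F normal_below by (simp add: N_def F_def field_simps)
  define t where "t = (r1 + r2 - r1 * r2) / D"
  have "r1 * r2 < r2" "0 < r2"
    using r1 r12 by auto
  hence prod: "0 \<le> r1 * r2" and "0 \<le> r1 + r2 - r1 * r2"
    using r1 by (auto intro!: order.trans[of "r1 * r2" r2 "r1 + r2"])
  hence t: "0 \<le> t" "t < 1"
    using contraction D by (auto simp: t_def)
  have step: "D * (x (Suc j) - N) = (r1 + r2) * (x j - N) - r1 * r2 * (x (j - 1) - N)" for j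
  proof -
    have "x (Suc j) = h j / D"
      using slack(1)[of j] x_Suc_le_iff[of j] above[of "Suc j"] by linarith
    hence "D * x (Suc j) = h j"
      using D by simp
    thus ?thesis
      using FN by (simp add: h_def F_def algebra_simps)
  qed
  \<comment> \<open>While \<open>x\<close> decreases, the lagged term may be replaced by the current
    one, which collapses the second-order recursion to a first-order contraction with factor
    \<open>t\<close>.\<close>
  have dec: "x (Suc j) - N \<le> t * (x j - N)" if "x j \<le> x (j - 1)" for j
  proof -
    have "r1 * r2 * (x j - N) \<le> r1 * r2 * (x (j - 1) - N)"
      using that prod by (intro mult_left_mono) auto
    hence "D * (x (Suc j) - N) \<le> (r1 + r2 - r1 * r2) * (x j - N)"
      unfolding step by (simp add: algebra_simps)
    thus ?thesis
      using D by (simp add: t_def field_simps)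
  qed
  \<comment> \<open>Monotonicity and \<open>dec\<close> support each other: one step of
    \<open>dec\<close> and \<open>N < b < x j\<close> give the next decrease. The induction starts
    because \<open>0 - 1 = 0\<close>.\<close>
  have mono: "x j \<le> x (j - 1)" for j
  proof (induction j)
    case (Suc j)
    have "t * (x j - N) \<le> 1 * (x j - N)"
      using t above[of j] N by (intro mult_right_mono) auto
    thus ?case
      using dec[OF Suc] by simp
  qed simp
  have geom: "x j - N \<le> t ^ j * (x 0 - N)" for j
  proof (induction j)
    case (Suc j)
    have "t * (x j - N) \<le> t * (t ^ j * (x 0 - N))"
      using t Suc by (intro mult_left_mono) auto
    thus ?case
      using dec[OF mono, of j] by (simp add: mult.assoc)
  qed simp
  have "(\<lambda>j. t ^ j * (x 0 - N)) \<longlonglongrightarrow> 0 * (x 0 - N)"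
    using t by (intro tendsto_intros LIMSEQ_realpow_zero) auto
  moreover have "b - N \<le> t ^ j * (x 0 - N)" for j
    using geom[of j] above[of j] by linarith
  ultimately have "b - N \<le> 0"
    by (intro LIMSEQ_le_const[of _ _ "b - N"]) auto
  thus False
    using N by simp
qed

text \<open>Since \<open>j\<close> counts remaining periods, this is also the threshold truncation
  length of the theorem.\<close>

definition entry :: nat where
  "entry = (LEAST j. x j \<le> b)"

lemma entry_binding: "x entry \<le> b"
  unfolding entry_def by (rule LeastI_ex[OF ex_binding])

lemma before_entry: "j < entry \<Longrightarrow> b < x j"
  unfolding entry_def by (meson not_le not_less_Least)

text \<open>This guarantees at least one normal-time low-state period at the end of the path, and
  makes \<open>entry - 1\<close> a genuine predecessor.\<close>

lemma entry_ge_2: "2 \<le> entry"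
proof -
  have "entry \<noteq> 0" "entry \<noteq> 1"
    using entry_binding x_0 x_1 b by (metis not_le)+
  thus ?thesis
    by linarith
qed

section \<open>Persistence of the ELB regime\<close>

lemma drift: "r2 * ((1 - r1) * b) + A - e < (1 - r1) * b"
proof -
  \<comment> \<open>By \<open>kink\<close>, \<open>(1 - D) * b = A\<close>; with this identity the
    claim is a rearrangement of \<open>normal_below\<close>.\<close>
  have "(1 - r1) * (1 - r2) * b = (D - (r1 + r2) + r1 * r2) * b + A"
    using kink by (simp add: algebra_simps)
  thus ?thesis
    using normal_below by (simp add: algebra_simps)
qed

text \<open>Factoring the characteristic polynomial: subtracting \<open>r1 * x (Suc j)\<close>
  leaves a first-order recursion with root \<open>r2\<close> for the quasi-difference.\<close>

lemma h_quasi_difference: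
  "h (Suc j) + A = r1 * x (Suc j) + r2 * (x (Suc j) - r1 * x j) + A - e"
  by (simp add: h_def algebra_simps)

text \<open>The bound on \<open>x\<close> alone is not carried by the induction. Together with the
  bound on the quasi-difference it is: \<open>drift\<close> preserves the latter, and
  \<open>r1 * b + (1 - r1) * b = b\<close> recovers the former.\<close>

lemma after_entry_aux:
  "x (entry + j) \<le> b \<and> x (entry + j) - r1 * x (entry + j - 1) \<le> (1 - r1) * b"
proof (induction j)
  case 0
  \<comment> \<open>Minimality of \<open>entry\<close> puts its predecessor above \<open>b\<close>,
    which bounds the initial quasi-difference.\<close>
  have "r1 * b \<le> r1 * x (entry - 1)"
    using before_entry[of "entry - 1"] entry_ge_2 r1 by (intro mult_left_mono) auto
  thus ?case
    using entry_binding by (simp add: algebra_simps)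
next
  case (Suc j)
  define m where "m = entry + j - 1"
  have m: "entry + j = Suc m"
    using entry_ge_2 by (simp add: m_def)
  have IH: "x (Suc m) \<le> b" "x (Suc m) - r1 * x m \<le> (1 - r1) * b"
    using Suc by (simp_all add: m)
  have "r1 * x (Suc m) \<le> r1 * b"
    using IH r1 by (intro mult_left_mono) auto
  moreover have q: "r2 * (x (Suc m) - r1 * x m) \<le> r2 * ((1 - r1) * b)"
    using IH r1 r12 by (intro mult_left_mono) auto
  ultimately have "h (Suc m) + A \<le> b"
    unfolding h_quasi_difference using drift by (simp add: algebra_simps)
  hence "h (Suc m) \<le> D * b"
    using kink by simp
  note * = binding[OF this]
  have "x (Suc (Suc m)) - r1 * x (Suc m) \<le> (1 - r1) * b"
    unfolding *(1) h_quasi_difference using q drift by simp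
  thus ?case
    using *(2) by (simp add: m)
qed

lemma after_entry: "entry \<le> j \<Longrightarrow> x j \<le> b"
  using after_entry_aux[of "j - entry"] by simp

lemma quasi_difference_le:
  "x (entry + j) - r1 * x (entry + j - 1) \<le> (1 - r1) * b"
  using after_entry_aux by blast

section \<open>Long-run behaviour on the ELB branch\<close>

lemma x_after_entry:
  "x (entry + Suc j) =
    (r1 + r2) * x (entry + j) - r1 * r2 * x (entry + j - 1) - e + A"
proof -
  have "x (Suc (entry + j)) \<le> b"
    by (rule after_entry) simp
  hence "h (entry + j) \<le> D * b"
    by (simp only: x_Suc_le_iff)
  from binding(1)[OF this] show ?thesis
    by (simp add: h_def)
qed

lemma tendsto_elb_fixed_point:
  assumes "r2 < 1"
  shows "x \<longlonglongrightarrow> (A - e) / ((1 - r1) * (1 - r2))"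
proof -
  define L where "L = (A - e) / ((1 - r1) * (1 - r2))"
  have "(1 - r1) * (1 - r2) * L = A - e"
    using assms r1 by (simp add: L_def)
  hence L: "(r1 + r2) * L - r1 * r2 * L - e + A = L"
    by (simp add: algebra_simps)
  define w where "w j = x (entry + j) - L" for j
  have rec: "w (Suc (Suc j)) = (r1 + r2) * w (Suc j) - r1 * r2 * w j" for j
    using x_after_entry[of "Suc j"] L by (simp add: w_def algebra_simps)
  \<comment> \<open>Deviations from the fixed point solve the homogeneous recursion with distinct
    roots; \<open>B\<close> and \<open>C\<close> are the coefficients of the closed form, scaled by
    \<open>r2 - r1\<close> and fitted to \<open>w 0\<close> and \<open>w 1\<close>.\<close>
  define B where "B = w 1 - r1 * w 0"
  define C where "C = w 1 - r2 * w 0"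
  have "(r2 - r1) * w j = B * r2 ^ j - C * r1 ^ j \<and>
      (r2 - r1) * w (Suc j) = B * r2 ^ Suc j - C * r1 ^ Suc j" for j
  proof (induction j)
    case 0
    show ?case
      by (simp add: B_def C_def algebra_simps)
  next
    case (Suc j)
    have "(r2 - r1) * w (Suc (Suc j)) =
        (r1 + r2) * ((r2 - r1) * w (Suc j)) - r1 * r2 * ((r2 - r1) * w j)"
      by (simp add: rec algebra_simps)
    also have "\<dots> = (r1 + r2) * (B * r2 ^ Suc j - C * r1 ^ Suc j)
        - r1 * r2 * (B * r2 ^ j - C * r1 ^ j)"
      using Suc by simp
    also have "\<dots> = B * r2 ^ Suc (Suc j) - C * r1 ^ Suc (Suc j)"
      by (simp add: algebra_simps)
    finally show ?case
      using Suc by simp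
  qed
  hence w: "w j = (B * r2 ^ j - C * r1 ^ j) / (r2 - r1)" for j
    using r12 by (simp add: eq_divide_eq mult.commute)
  have "(\<lambda>j. (B * r2 ^ j - C * r1 ^ j) / (r2 - r1)) \<longlonglongrightarrow> (B * 0 - C * 0) / (r2 - r1)"
    using r1 r12 assms by (intro tendsto_intros LIMSEQ_realpow_zero) auto
  hence "w \<longlonglongrightarrow> 0"
    by (simp add: w[abs_def])
  hence "(\<lambda>j. w j + L) \<longlonglongrightarrow> 0 + L"
    by (intro tendsto_intros)
  hence "(\<lambda>j. x (j + entry)) \<longlonglongrightarrow> L"
    by (simp add: w_def add.commute)
  thus ?thesis
    unfolding L_def[symmetric] by (rule LIMSEQ_offset)
qed

lemma tendsto_at_bot:
  assumes "1 \<le> r2"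
  shows "filterlim x at_bot sequentially"
proof -
  define q where "q j = x (entry + j) - r1 * x (entry + j - 1)" for j
  \<comment> \<open>The gap in \<open>drift\<close>, which is a uniform lower bound on the fall of
    the quasi-difference per step.\<close>
  define \<epsilon> where "\<epsilon> = (1 - r1) * b - (r2 * ((1 - r1) * b) + A - e)"
  have \<epsilon>: "\<epsilon> > 0"
    using drift by (simp add: \<epsilon>_def)
  have q_le: "q j \<le> q 0 - real j * \<epsilon>" for j
  proof (induction j)
    case (Suc j)
    have "q (Suc j) = r2 * q j + A - e"
      using x_after_entry[of j] by (simp add: q_def algebra_simps)
    also have "\<dots> = q j + (r2 - 1) * q j + A - e"
      by (simp add: algebra_simps)
    \<comment> \<open>As \<open>r2 - 1\<close> is nonnegative, the bound on the quasi-difference may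
      be multiplied by it.\<close>
    also have "(r2 - 1) * q j \<le> (r2 - 1) * ((1 - r1) * b)"
      using quasi_difference_le[of j] assms unfolding q_def by (intro mult_left_mono) auto
    finally have "q (Suc j) \<le> q j - \<epsilon>"
      by (simp add: \<epsilon>_def algebra_simps)
    thus ?case
      using Suc by (simp add: algebra_simps)
  qed simp
  \<comment> \<open>Since \<open>x\<close> is negative after entry, it lies below its own
    quasi-difference.\<close>
  have x_le: "x (Suc j + entry) \<le> q 0 - real (Suc j) * \<epsilon>" for j
  proof -
    have "x (entry + j) \<le> b"
      by (rule after_entry) simp
    hence "r1 * x (entry + j) \<le> 0"
      using b r1 by (intro mult_nonneg_nonpos) auto
    hence "x (entry + Suc j) \<le> q (Suc j)"
      by (simp add: q_def)
    thus ?thesis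
      using q_le[of "Suc j"] by (simp add: add.commute)
  qed
  have "filterlim (\<lambda>j. x (j + Suc entry)) at_bot sequentially"
    unfolding filterlim_at_bot
  proof
    fix Z :: real
    obtain n where n: "(q 0 - Z) / \<epsilon> \<le> real n"
      using real_arch_simple by blast
    have "x (j + Suc entry) \<le> Z" if "n \<le> j" for j
    proof -
      have "(q 0 - Z) / \<epsilon> \<le> real (Suc j)"
        using n that by simp
      hence "q 0 - Z \<le> real (Suc j) * \<epsilon>"
        using \<epsilon> by (simp only: pos_divide_le_eq)
      thus ?thesis
        using x_le[of j] by simp
    qed
    thus "\<forall>\<^sub>F j in sequentially. x (j + Suc entry) \<le> Z"
      by (rule eventually_sequentiallyI)
  qed
  thus ?thesis
    unfolding filterlim_def eventually_filtermap le_filter_def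
    using eventually_sequentially_seg by blast
qed

end

section \<open>Low-state inflation of the model\<close>

text \<open>The argument counts remaining low-state periods. The coefficients of the two lags are
  the trace and minus the determinant of \<open>p *\<^sub>R A_star P\<close>; in the last period
  both lags are the terminal value 0.\<close>

fun low_inflation :: "params \<Rightarrow> real \<Rightarrow> real \<Rightarrow> nat \<Rightarrow> real" where
  "low_inflation P d p 0 = 0"
| "low_inflation P d p (Suc j) =
    (let h = p * (m_xx P + \<beta> P * m_pipi P + \<sigma> P * slope P * m_xpi P) * low_inflation P d p j
           - p\<^sup>2 * (m_xx P * (\<beta> P * m_pipi P)) * low_inflation P d p (j - 1)
           - slope P * \<sigma> P * d
     in min (h + slope P * \<sigma> P * \<mu> P) (h / (1 + slope P * \<sigma> P * \<psi> P)))"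

text \<open>The interest rate reacts to the inflation it helps to determine. Each regime makes this
  implicit equation linear, and the solution for the regime not in force is never the smaller
  one.\<close>

lemma inflation_max_eq_min:
  fixes y h k f m :: real
  assumes "k > 0" "f > 0" "y = h - k * max (f * y) (- m)"
  shows "y = min (h + k * m) (h / (1 + k * f))"
proof -
  have D: "1 + k * f > 0"
    using assms by (simp add: add_pos_pos)
  show ?thesis
  proof (cases "- m \<le> f * y")
    case True
    hence "y = h - k * (f * y)"
      using assms(3) by (simp only: max_absorb1)
    hence "h = y * (1 + k * f)"
      by (simp add: algebra_simps)
    hence "h / (1 + k * f) = y"
      using D by simp
    moreover have "k * (- m) \<le> k * (f * y)"
      using True assms(1) by (intro mult_left_mono) auto
    hence "y \<le> h + k * m"
      using \<open>y = h - k * (f * y)\<close> by simp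
    ultimately show ?thesis
      by simp
  next
    case False
    hence h: "h = y - k * m"
      using assms(3) by (simp add: max_def)
    have "k * (f * y) \<le> k * (- m)"
      using False assms(1) by (intro mult_left_mono) auto
    hence "y \<le> h / (1 + k * f)"
      using D by (simp add: h field_simps)
    thus ?thesis
      by (simp add: h)
  qed
qed

text \<open>Backward induction from the last low-state period. Consumption is recovered from
  inflation by the Phillips curve.\<close>

lemma tilde_eq:
  assumes P: "admissible P" and p: "0 < p" "p < 1" and n: "n < l"
  shows "pi_tilde P d p l n = low_inflation P d p (l - n)"
    and "c_tilde P d p l n =
      (low_inflation P d p (l - n) - p * (\<beta> P * m_pipi P) * low_inflation P d p (l - n - 1))
        / slope P"
proof -
  define K where "K = slope P"
  define b where "b = \<beta> P * m_pipi P"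
  let ?x = "low_inflation P d p"
  have K: "K > 0" and pos: "\<sigma> P > 0" "\<psi> P > 0"
    using slope_pos[OF P] P by (auto simp: K_def admissible_def)
  obtain c \<pi> i where the_eq: "the_equilibrium P d p l = (c, \<pi>, i)"
    by (metis prod_cases3)
  have "case the_equilibrium P d p l of (c, \<pi>, i) \<Rightarrow> equilibrium P d p l c \<pi> i"
    unfolding the_equilibrium_def by (rule theI'[OF ex1_equilibrium[OF P]]) (use p in auto)
  hence eq: "equilibrium P d p l c \<pi> i"
    by (simp add: the_eq)
  hence abs: "c m Absorbing = 0" "\<pi> m Absorbing = 0" for m
    unfolding equilibrium_def by blast+
  have E: "cond_exp_next p l u m Low = (if m + 1 < l then p * u (m + 1) Low else 0)"
    if "\<And>m. u m Absorbing = 0" for u m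
    using cond_exp_next_Low[of p l u m] p that by simp
  have c_Low: "c m Low = m_xx P * cond_exp_next p l c m Low
      - \<sigma> P * (max (\<psi> P * \<pi> m Low) (- \<mu> P) - m_xpi P * cond_exp_next p l \<pi> m Low + d)"
    and pi_Low: "\<pi> m Low = m_pipi P * \<beta> P * cond_exp_next p l \<pi> m Low + K * c m Low" for m
    using eq[unfolded equilibrium_def, THEN conjunct1, rule_format, of m Low]
    unfolding K_def shock_value.simps by metis+
  \<comment> \<open>Consumption is carried along because the Euler equation contains its
    expectation; expressing it by two inflation values is what makes the recursion
    second-order.\<close>
  have main: "\<pi> m Low = ?x (Suc j) \<and> K * c m Low = ?x (Suc j) - p * b * ?x j"
    if "m + Suc j = l" for m j
    using that
  proof (induction j arbitrary: m)
    case (0 m)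
    have Ez: "cond_exp_next p l c m Low = 0" "cond_exp_next p l \<pi> m Low = 0"
      using 0 by (simp_all add: E abs)
    have c: "c m Low = - \<sigma> P * (max (\<psi> P * \<pi> m Low) (- \<mu> P) + d)"
      and y: "\<pi> m Low = K * c m Low"
      using c_Low[of m] pi_Low[of m] unfolding Ez by simp_all
    have "\<pi> m Low = - K * \<sigma> P * d - K * \<sigma> P * max (\<psi> P * \<pi> m Low) (- \<mu> P)"
      by (subst y, subst c) (simp add: algebra_simps)
    from inflation_max_eq_min[OF _ _ this] show ?case
      using K pos y by (simp add: Let_def K_def)
  next
    case (Suc j m)
    have "Suc m + Suc j = l" and lt: "m + 1 < l"
      using Suc.prems by simp_all
    from Suc.IH[OF this(1)]
    have IH: "\<pi> (Suc m) Low = ?x (Suc j)" "K * c (Suc m) Low = ?x (Suc j) - p * b * ?x j"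
      by simp_all
    have Ex: "cond_exp_next p l c m Low = p * c (Suc m) Low"
      "cond_exp_next p l \<pi> m Low = p * ?x (Suc j)"
      using lt IH by (simp_all add: E abs del: low_inflation.simps)
    have c: "c m Low = m_xx P * (p * c (Suc m) Low)
        - \<sigma> P * (max (\<psi> P * \<pi> m Low) (- \<mu> P) - m_xpi P * (p * ?x (Suc j)) + d)"
      and y: "\<pi> m Low = b * (p * ?x (Suc j)) + K * c m Low"
      using c_Low[of m] pi_Low[of m] unfolding Ex b_def by (simp_all only: ac_simps)
    let ?h = "p * (m_xx P + b + \<sigma> P * K * m_xpi P) * ?x (Suc j)
           - p\<^sup>2 * (m_xx P * b) * ?x j - K * \<sigma> P * d"
    \<comment> \<open>Scaling the Euler equation by \<open>K\<close> exposes
      \<open>K * c (Suc m) Low\<close>, which the induction hypothesis eliminates.\<close>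
    have "K * c m Low = m_xx P * p * (K * c (Suc m) Low)
        - K * \<sigma> P * (max (\<psi> P * \<pi> m Low) (- \<mu> P) - m_xpi P * (p * ?x (Suc j)) + d)"
      by (subst c) (simp only: algebra_simps)
    hence "\<pi> m Low = ?h - K * \<sigma> P * max (\<psi> P * \<pi> m Low) (- \<mu> P)"
      unfolding IH using y by (simp only: algebra_simps power2_eq_square)
    from inflation_max_eq_min[OF _ _ this]
    have "\<pi> m Low = min (?h + K * \<sigma> P * \<mu> P) (?h / (1 + K * \<sigma> P * \<psi> P))"
      using K pos by simp
    also have "\<dots> = ?x (Suc (Suc j))"
      by (subst low_inflation.simps(2)[of _ _ _ "Suc j"])
        (simp only: Let_def K_def b_def diff_Suc_1)
    finally have "\<pi> m Low = ?x (Suc (Suc j))" .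
    moreover from this have "K * c m Low = ?x (Suc (Suc j)) - b * (p * ?x (Suc j))"
      using y by linarith
    ultimately show ?case
      by (simp only: ac_simps simp_thms)
  qed
  obtain j where j: "l - n = Suc j"
    using n by (metis Suc_diff_Suc)
  have "n + Suc j = l"
    using j n by linarith
  from main[OF this] K
  show "pi_tilde P d p l n = ?x (l - n)"
    and "c_tilde P d p l n =
      (?x (l - n) - p * (\<beta> P * m_pipi P) * ?x (l - n - 1)) / slope P"
    by (simp_all add: pi_tilde_def c_tilde_def the_eq j K_def b_def field_simps
        del: low_inflation.simps)
qed

section \<open>Thresholds\<close>

lemma F_N_eq: "F_N P p = F_L P p + \<sigma> P * \<psi> P * slope P"
  by (simp add: F_N_def F_L_eq algebra_simps)

text \<open>The difference factors as \<open>(y - x) * (a + b + g - a * b * (x + y))\<close>, and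
  the second factor is at least \<open>g > 0\<close> on the unit interval. By \<open>F_N_eq\<close>
  the same monotonicity passes to \<open>F_N\<close> and \<open>d_bar\<close>.\<close>

lemma F_L_strict_antimono:
  assumes P: "admissible P" and "0 \<le> x" "x < y" "y \<le> 1"
  shows "F_L P y < F_L P x"
proof -
  define a where "a = m_xx P"
  define b where "b = \<beta> P * m_pipi P"
  define g where "g = \<sigma> P * slope P * m_xpi P"
  have a: "0 < a" "a \<le> 1" and b: "0 < b" "b \<le> 1" and g: "0 < g"
    using P slope_pos[OF P] by (auto simp: a_def b_def g_def admissible_def mult_le_one)
  have "a * b * x \<le> b" "a * b * y \<le> a"
  proof -
    have "a * x \<le> 1"
      using a assms by (intro mult_le_one) auto
    thus "a * b * x \<le> b"
      using b mult_left_mono[of "a * x" 1 b] by (simp add: mult.assoc mult.left_commute)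
    have "b * y \<le> 1"
      using b assms by (intro mult_le_one) auto
    thus "a * b * y \<le> a"
      using a mult_left_mono[of "b * y" 1 a] by (simp add: mult.assoc)
  qed
  hence "0 < (y - x) * (a + b + g - a * b * (x + y))"
    using assms g by (intro mult_pos_pos) (auto simp: algebra_simps)
  also have "\<dots> = F_L P x - F_L P y"
    by (simp add: F_L_eq a_def b_def g_def algebra_simps)
  finally show ?thesis
    by simp
qed

text \<open>The restriction on psi rearranges to this; monotonicity then makes \<open>F_N\<close>
  positive on the whole unit interval.\<close>

lemma F_N_1_pos:
  assumes P: "admissible P"
    and "\<psi> P > m_xpi P + (1 - m_xx P) * (\<beta> P * m_pipi P - 1) /
           (\<kappa> P * (1 + \<eta> P * cbar P) * \<sigma> P)"
  shows "0 < F_N P 1"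
proof -
  have pos: "slope P * \<sigma> P > 0"
    using P slope_pos[OF P] by (simp add: admissible_def)
  have "(1 - m_xx P) * (\<beta> P * m_pipi P - 1) / (slope P * \<sigma> P) < \<psi> P - m_xpi P"
    using assms(2) unfolding slope_def[symmetric] by simp
  hence "(1 - m_xx P) * (\<beta> P * m_pipi P - 1) < (\<psi> P - m_xpi P) * (slope P * \<sigma> P)"
    using pos by (simp only: pos_divide_less_eq)
  thus ?thesis
    by (simp add: F_N_def algebra_simps)
qed

lemma p_bar:
  assumes "admissible P" "F_L P 1 < 0"
  shows "0 < p_bar P" "p_bar P < 1" "F_L P (p_bar P) = 0"
  using theI'[OF ex1_p_bar[OF assms]] unfolding p_bar_def by blast+

text \<open>The candidate is checked in the linear system and the left inverse applied, so the
  inverse is never computed.\<close>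

lemma elb_solution_eq:
  fixes d :: real
  assumes P: "admissible P" and F: "F_L P p \<noteq> 0"
  defines "y \<equiv> slope P * \<sigma> P * (\<mu> P - d) / F_L P p"
  shows "elb_solution P d p = vector [(1 - p * (\<beta> P * m_pipi P)) * y / slope P, y]"
proof -
  let ?M = "mat 1 - p *\<^sub>R A_star P"
  let ?v = "vector [(1 - p * (\<beta> P * m_pipi P)) * y / slope P, y] :: real^2"
  have K: "slope P > 0"
    using slope_pos[OF P] .
  have "invertible ?M"
    using F by (simp add: invertible_det_nz F_L_def)
  hence inv_left: "matrix_inv ?M ** ?M = mat 1"
    unfolding invertible_def matrix_inv_def by (rule someI_ex[THEN conjunct2])
  have y: "F_L P p * y = slope P * \<sigma> P * (\<mu> P - d)"
    using F by (simp add: y_def)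
  have "(1 - p * m_xx P) * ((1 - p * (\<beta> P * m_pipi P)) * y / slope P) - p * (\<sigma> P * m_xpi P) * y
      = F_L P p * y / slope P"
    using K by (simp add: F_L_eq field_simps)
  hence y1: "(1 - p * m_xx P) * ((1 - p * (\<beta> P * m_pipi P)) * y / slope P) - p * (\<sigma> P * m_xpi P) * y
      = \<sigma> P * (\<mu> P - d)"
    using y K by simp
  have "(?M *v ?v) $ 1 = (d *\<^sub>R C_star P + E_star P) $ 1"
    using y1 by (simp add: matrix_vector_mult_def sum_2 mat_def A_star_def C_star_def E_star_def
        algebra_simps diff_divide_distrib)
  moreover have "(?M *v ?v) $ 2 = (d *\<^sub>R C_star P + E_star P) $ 2"
  proof -
    have "(?M *v ?v) $ 2 = F_L P p * y"
      using K by (simp add: matrix_vector_mult_def sum_2 mat_def A_star_def F_L_eq algebra_simps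
          diff_divide_distrib)
    thus ?thesis
      unfolding y by (simp add: C_star_def E_star_def algebra_simps)
  qed
  ultimately have "?M *v ?v = d *\<^sub>R C_star P + E_star P"
    by (simp add: vec_eq_iff forall_2)
  hence "elb_solution P d p = matrix_inv ?M *v (?M *v ?v)"
    by (simp add: elb_solution_def)
  also have "\<dots> = ?v"
    using inv_left by (simp add: matrix_vector_mul_assoc)
  finally show ?thesis .
qed

section \<open>From the model to the scalar recursion\<close>

lemma low_inflation_elb_recursion:
  assumes P: "admissible P" and p: "0 < p" "p < 1"
    and d: "d_bar P p < d" "d < d_bar P 0" and FN: "0 < F_N P p"
  obtains r1 r2 where
    "elb_recursion (low_inflation P d p) r1 r2 (slope P * \<sigma> P * \<mu> P) (1 + slope P * \<sigma> P * \<psi> P)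
       (pi_bar P) (slope P * \<sigma> P * d)"
    "(1 - r1) * (1 - r2) = F_L P p"
proof -
  define a where "a = m_xx P"
  define b where "b = \<beta> P * m_pipi P"
  define g where "g = \<sigma> P * slope P * m_xpi P"
  \<comment> \<open>\<open>T\<close> and \<open>\<Delta>\<close> are trace and determinant of
    \<open>p *\<^sub>R A_star P\<close>, so \<open>r1\<close> and \<open>r2\<close> below are its
    eigenvalues.\<close>
  define T where "T = p * (a + b + g)"
  define \<Delta> where "\<Delta> = p\<^sup>2 * (a * b)"
  have a: "0 < a" "a \<le> 1" and b: "0 < b" "b \<le> 1" and g: "0 < g"
    and pos: "\<sigma> P > 0" "\<psi> P > 0" "\<mu> P > 0" "slope P > 0"
    using P slope_pos[OF P] by (auto simp: a_def b_def g_def admissible_def mult_le_one)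
  have T: "T > 0" and \<Delta>: "\<Delta> > 0"
    using p a b g by (auto simp: T_def \<Delta>_def)
  have "\<Delta> < 1"
  proof -
    have "p\<^sup>2 < 1"
      using p by (simp add: power_less_one_iff)
    moreover have "a * b \<le> 1"
      using a b by (simp add: mult_le_one)
    ultimately have "p\<^sup>2 * (a * b) \<le> p\<^sup>2 * 1"
      by (intro mult_left_mono) auto
    thus ?thesis
      using \<open>p\<^sup>2 < 1\<close> by (simp add: \<Delta>_def)
  qed
  \<comment> \<open>The discriminant as a sum of nonnegative terms with a positive one: the
    eigenvalues are real and distinct.\<close>
  have "0 < p\<^sup>2 * ((a - b)\<^sup>2 + g\<^sup>2 + 2 * (a + b) * g)"
    using p a b g by (intro mult_pos_pos add_nonneg_pos) auto
  also have "\<dots> = T\<^sup>2 - 4 * \<Delta>"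
    by (simp add: T_def \<Delta>_def power2_eq_square algebra_simps)
  finally have disc: "0 < T\<^sup>2 - 4 * \<Delta>" .
  define s where "s = sqrt (T\<^sup>2 - 4 * \<Delta>)"
  have s: "0 < s" "s\<^sup>2 = T\<^sup>2 - 4 * \<Delta>"
    using disc by (auto simp: s_def)
  define r1 where "r1 = (T - s) / 2"
  define r2 where "r2 = (T + s) / 2"
  have sum: "r1 + r2 = T"
    by (simp add: r1_def r2_def field_simps)
  have prod: "r1 * r2 = \<Delta>"
    using s(2) by (simp add: r1_def r2_def field_simps power2_eq_square)
  have r12: "r1 < r2" and r2: "0 < r2"
    using s T by (auto simp: r1_def r2_def)
  have r1: "0 < r1"
    using prod \<Delta> r2 by (metis zero_less_mult_pos2)
  \<comment> \<open>Otherwise both eigenvalues would be at least 1, against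
    \<open>\<Delta> < 1\<close>.\<close>
  have "r1 < 1"
  proof (rule ccontr)
    assume "\<not> r1 < 1"
    hence "1 * 1 \<le> r1 * r2"
      using r12 by (intro mult_mono) auto
    thus False
      using prod \<open>\<Delta> < 1\<close> by simp
  qed
  have FL: "F_L P p = 1 - T + \<Delta>"
    by (simp add: F_L_eq T_def \<Delta>_def a_def b_def g_def power2_eq_square algebra_simps)
  define D where "D = 1 + slope P * \<sigma> P * \<psi> P"
  have D: "1 < D"
    using pos by (simp add: D_def)
  have FND: "F_N P p = D - T + \<Delta>"
    by (simp add: F_N_eq FL D_def algebra_simps)
  have "F_N P 0 = D"
    by (simp add: F_N_def D_def algebra_simps)
  hence d0: "slope P * \<sigma> P * d < D * (\<mu> P / \<psi> P)"
    using d(2) pos by (simp add: d_bar_def field_simps)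
  have dp: "F_N P p * (\<mu> P / \<psi> P) < slope P * \<sigma> P * d"
    using d(1) pos by (simp add: d_bar_def field_simps)
  show ?thesis
  proof (rule that)
    show "elb_recursion (low_inflation P d p) r1 r2 (slope P * \<sigma> P * \<mu> P)
       (1 + slope P * \<sigma> P * \<psi> P) (pi_bar P) (slope P * \<sigma> P * d)"
      unfolding D_def[symmetric]
    proof
      fix j
      show "low_inflation P d p (Suc j) =
        min ((r1 + r2) * low_inflation P d p j - r1 * r2 * low_inflation P d p (j - 1)
               - slope P * \<sigma> P * d + slope P * \<sigma> P * \<mu> P)
          (((r1 + r2) * low_inflation P d p j - r1 * r2 * low_inflation P d p (j - 1)
               - slope P * \<sigma> P * d) / D)"
        unfolding sum prod low_inflation.simps(2)[of P d p j] Let_def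
        by (simp only: T_def \<Delta>_def a_def b_def g_def D_def)
      show "D * pi_bar P = pi_bar P - slope P * \<sigma> P * \<mu> P"
        using pos by (simp add: D_def pi_bar_def field_simps)
      show "- (slope P * \<sigma> P * d) < (D - (r1 + r2) + r1 * r2) * pi_bar P"
        using dp by (simp add: sum prod FND pi_bar_def)
      show "D * pi_bar P < - (slope P * \<sigma> P * d)"
        using d0 by (simp add: pi_bar_def)
    qed (use r1 r12 \<open>r1 < 1\<close> D pos FN in \<open>auto simp: sum prod FND pi_bar_def\<close>)
    show "(1 - r1) * (1 - r2) = F_L P p"
      using sum prod by (simp add: FL algebra_simps)
  qed
qed

theorem proposition5:
  fixes P :: params
  assumes "admissible P"
    and "F_L P 1 < 0"
    and "\<psi> P > m_xpi P + (1 - m_xx P) * (\<beta> P * m_pipi P - 1) /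
           (\<kappa> P * (1 + \<eta> P * cbar P) * \<sigma> P)"
  shows "strict_antimono_on {0<..<1} (d_bar P) \<and>
    (\<forall>p d. 0 < p \<longrightarrow> p < 1 \<longrightarrow> d_bar P p < d \<longrightarrow> d < d_bar P 0 \<longrightarrow>
       (\<exists>lmin::nat. \<forall>l\<ge>1.
          (l \<ge> lmin \<longrightarrow>
             pi_tilde P d p l 0 \<le> pi_bar P \<and>
             (\<exists>k. k + 2 \<le> l \<and>
                (\<forall>n\<le>k. pi_tilde P d p l n \<le> pi_bar P) \<and>
                (\<forall>n. k < n \<and> n < l \<longrightarrow> pi_tilde P d p l n > pi_bar P))) \<and>
          (l < lmin \<longrightarrow> (\<forall>n<l. pi_tilde P d p l n > pi_bar P))) \<and>
       (p < p_bar P \<longrightarrow>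
          ((\<lambda>l. pi_tilde P d p l 0) \<longlonglongrightarrow> elb_solution P d p $ 2) \<and>
          ((\<lambda>l. c_tilde P d p l 0) \<longlonglongrightarrow> elb_solution P d p $ 1)) \<and>
       (p \<ge> p_bar P \<longrightarrow>
          filterlim (\<lambda>l. pi_tilde P d p l 0) at_bot sequentially))"
proof -
  note P = assms(1)
  have pos: "\<sigma> P > 0" "\<psi> P > 0" "\<mu> P > 0" "slope P > 0"
    using P slope_pos[OF P] by (auto simp: admissible_def)
  show ?thesis
  proof (intro conjI allI impI)
    show "strict_antimono_on {0<..<1} (d_bar P)"
    proof (rule monotone_onI)
      fix x y :: real assume xy: "x \<in> {0<..<1}" "y \<in> {0<..<1}" "x < y"
      hence "F_N P y < F_N P x"
        using F_L_strict_antimono[OF P, of x y] by (simp add: F_N_eq)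
      thus "d_bar P y < d_bar P x"
        using pos unfolding d_bar_def by (intro divide_strict_right_mono mult_strict_left_mono) auto
    qed
  next
    fix p d
    assume p: "0 < p" "p < 1" and d: "d_bar P p < d" "d < d_bar P 0"
    let ?x = "low_inflation P d p"
    have "0 < F_N P p"
      using F_N_1_pos[OF P assms(3)] F_L_strict_antimono[OF P, of p 1] p by (simp add: F_N_eq)
    from low_inflation_elb_recursion[OF P p d this] obtain r1 r2 where
      rec: "elb_recursion ?x r1 r2 (slope P * \<sigma> P * \<mu> P) (1 + slope P * \<sigma> P * \<psi> P)
        (pi_bar P) (slope P * \<sigma> P * d)"
      and F: "(1 - r1) * (1 - r2) = F_L P p" .
    interpret elb_recursion ?x r1 r2 "slope P * \<sigma> P * \<mu> P" "1 + slope P * \<sigma> P * \<psi> P"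
      "pi_bar P" "slope P * \<sigma> P * d"
      by (fact rec)
    note pi_eq = tilde_eq(1)[OF P p] and c_eq = tilde_eq(2)[OF P p]
    \<comment> \<open>\<open>tilde_eq\<close> needs a date below \<open>l\<close>, so
      \<open>l = 0\<close> is excluded.\<close>
    have ev_pi: "\<forall>\<^sub>F l in sequentially. ?x l = pi_tilde P d p l 0"
      using eventually_gt_at_top[of 0] by eventually_elim (simp add: pi_eq)
    show "\<exists>lmin::nat. \<forall>l\<ge>1.
          (l \<ge> lmin \<longrightarrow>
             pi_tilde P d p l 0 \<le> pi_bar P \<and>
             (\<exists>k. k + 2 \<le> l \<and>
                (\<forall>n\<le>k. pi_tilde P d p l n \<le> pi_bar P) \<and>
                (\<forall>n. k < n \<and> n < l \<longrightarrow> pi_tilde P d p l n > pi_bar P))) \<and>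
          (l < lmin \<longrightarrow> (\<forall>n<l. pi_tilde P d p l n > pi_bar P))"
    \<comment> \<open>Date \<open>n\<close> has \<open>l - n\<close> low-state periods left, so time
      runs backwards along \<open>?x\<close>: late entry in \<open>j\<close> is early binding in
      \<open>n\<close>.\<close>
    proof (rule exI[of _ entry], intro allI impI conjI)
      fix l assume l: "1 \<le> l" "entry \<le> l"
      show "pi_tilde P d p l 0 \<le> pi_bar P"
        using l after_entry[of l] by (simp add: pi_eq)
      show "\<exists>k. k + 2 \<le> l \<and> (\<forall>n\<le>k. pi_tilde P d p l n \<le> pi_bar P) \<and>
                (\<forall>n. k < n \<and> n < l \<longrightarrow> pi_tilde P d p l n > pi_bar P)"
      \<comment> \<open>The last date with at least \<open>entry\<close> periods left.\<close>
      proof (intro exI[of _ "l - entry"] conjI allI impI)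
        show "l - entry + 2 \<le> l"
          using l entry_ge_2 by linarith
      next
        fix n assume "n \<le> l - entry"
        hence "n < l" "entry \<le> l - n"
          using l entry_ge_2 by linarith+
        thus "pi_tilde P d p l n \<le> pi_bar P"
          by (simp add: pi_eq after_entry)
      next
        fix n assume "l - entry < n \<and> n < l"
        hence "n < l" "l - n < entry"
          by linarith+
        thus "pi_bar P < pi_tilde P d p l n"
          by (simp add: pi_eq before_entry)
      qed
    next
      fix l n assume "l < entry" "n < l"
      thus "pi_bar P < pi_tilde P d p l n"
        by (simp add: pi_eq before_entry)
    qed
    note r1_less = r1(2)
    {
      assume "p < p_bar P"
      hence FL: "0 < F_L P p"
        using F_L_strict_antimono[OF P, of p "p_bar P"] p_bar[OF P assms(2)] p by simp
      \<comment> \<open>As \<open>1 - r1 > 0\<close>, the sign of \<open>F_L P p\<close> is that of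
        \<open>1 - r2\<close>.\<close>
      hence "r2 < 1"
        using F r1_less by (metis diff_gt_0_iff_gt zero_less_mult_pos)
      define y where "y = slope P * \<sigma> P * (\<mu> P - d) / F_L P p"
      have lim: "?x \<longlonglongrightarrow> y"
        using tendsto_elb_fixed_point[OF \<open>r2 < 1\<close>]
        unfolding F y_def right_diff_distrib[of "slope P * \<sigma> P"] .
      have sol: "elb_solution P d p = vector [(1 - p * (\<beta> P * m_pipi P)) * y / slope P, y]"
        unfolding y_def using FL by (intro elb_solution_eq[OF P]) simp
      show "(\<lambda>l. pi_tilde P d p l 0) \<longlonglongrightarrow> elb_solution P d p $ 2"
        using Lim_transform_eventually[OF lim ev_pi] by (simp add: sol)
      have "(\<lambda>l. ?x (l - 1)) \<longlonglongrightarrow> y"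
        by (rule LIMSEQ_offset[of _ 1]) (simp add: lim)
      with lim have "(\<lambda>l. (?x l - p * (\<beta> P * m_pipi P) * ?x (l - 1)) / slope P)
          \<longlonglongrightarrow> (y - p * (\<beta> P * m_pipi P) * y) / slope P"
        using pos by (intro tendsto_intros) auto
      moreover have "\<forall>\<^sub>F l in sequentially.
          (?x l - p * (\<beta> P * m_pipi P) * ?x (l - 1)) / slope P = c_tilde P d p l 0"
        using eventually_gt_at_top[of 0] by eventually_elim (simp add: c_eq)
      ultimately have "(\<lambda>l. c_tilde P d p l 0) \<longlonglongrightarrow> (y - p * (\<beta> P * m_pipi P) * y) / slope P"
        by (rule Lim_transform_eventually)
      thus "(\<lambda>l. c_tilde P d p l 0) \<longlonglongrightarrow> elb_solution P d p $ 1"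
        by (simp add: sol left_diff_distrib)
    next
      assume "p_bar P \<le> p"
      hence "F_L P p \<le> 0"
        using F_L_strict_antimono[OF P, of "p_bar P" p] p_bar[OF P assms(2)] p
        by (cases "p = p_bar P") auto
      hence "1 \<le> r2"
        using F r1_less mult_pos_pos[of "1 - r1" "1 - r2"] by linarith
      from tendsto_at_bot[OF this]
      show "filterlim (\<lambda>l. pi_tilde P d p l 0) at_bot sequentially"
        using filterlim_cong[OF refl refl ev_pi] by blast
    }
  qed
qed

end
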